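(* Let $\mathcal{I}$ and $\mathcal{K}$ be ideals on a set $S$ and let $X$ be a first countable topological space. If the ideal $\mathcal{I}$ has the additive property with respect to $\mathcal{K}$ (that is, $\mathrm{AP}(\mathcal{I},\mathcal{K})$ holds), then for every function $f\colon S\to X$ and every $x\in X$: if $f$ is $\mathcal{I}$-convergent to $x$, then $f$ is $\mathcal{I}^{\mathcal{K}}$-convergent to $x$.
   Context: An ideal on a set $S$ is a system $\mathcal{I}\subseteq\mathcal{P}(S)$ with $\emptyset\in\mathcal{I}$, closed under finite unions and under taking subsets; it is not required to be proper (i.e. $S\in\mathcal I$ is allowed) nor to contain the singletons. $\mathcal{F}(\mathcal{I})=\{S\setminus A : A\in\mathcal{I}\}$ denotes the associated filter. A function $f\colon S\to X$ into a topological space is $\mathcal{I}$-convergent to $x\in X$ if $f^{-1}(U)\in\mathcal{F}(\mathcal{I})$ for every neighborhood $U$ of $x$. For ideals $\mathcal{I},\mathcal{K}$ on $S$, $f\colon S\to X$ is $\mathcal{I}^{\mathcal{K}}$-convergent to $x\in X$ if there exists $M\in\mathcal{F}(\mathcal{I})$ such that the function $g\colon S\to X$ given by $g(s)=f(s)$ for $s\in M$ and $g(s)=x$ for $s\notin M$ is $\mathcal{K}$-convergent to $x$. $\mathcal{I}$ has the additive property with respect to $\mathcal{K}$, written $\mathrm{AP}(\mathcal{I},\mathcal{K})$, if for every sequence $(A_n)_{n\in\mathbb{N}}$ of sets from $\mathcal{I}$ there is $A\in\mathcal{I}$ such that $A_n\setminus A\in\mathcal{K}$ for all $n\in\mathbb{N}$.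 *)

theory Defs
  imports "HOL-Analysis.Analysis"
begin

text \<open>Ideals need neither be proper nor contain the singletons.\<close>

definition set_ideal :: "'a set \<Rightarrow> 'a set set \<Rightarrow> bool" where
  "set_ideal S I \<longleftrightarrow>
     I \<subseteq> Pow S \<and> {} \<in> I \<and>
     (\<forall>A\<in>I. \<forall>B\<in>I. A \<union> B \<in> I) \<and>
     (\<forall>A\<in>I. \<forall>B. B \<subseteq> A \<longrightarrow> B \<in> I)"

definition dual_filter :: "'a set \<Rightarrow> 'a set set \<Rightarrow> 'a set set" where
  "dual_filter S I = {S - A |A. A \<in> I}"

text \<open>Neighbourhoods are not required to be open.\<close>

definition nbhd :: "'b topology \<Rightarrow> 'b \<Rightarrow> 'b set \<Rightarrow> bool" where
  "nbhd X x U \<longleftrightarrow> U \<subseteq> topspace X \<and> (\<exists>V. openin X V \<and> x \<in> V \<and> V \<subseteq> U)"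

text \<open>
  The two notions of convergence below are meant for functions from \<open>S\<close> to \<open>topspace X\<close> and for
  points \<open>x\<close> of \<open>topspace X\<close>; the preimage of \<open>U\<close> is taken in \<open>S\<close>.
\<close>

definition ideal_conv ::
  "'a set \<Rightarrow> 'a set set \<Rightarrow> 'b topology \<Rightarrow> ('a \<Rightarrow> 'b) \<Rightarrow> 'b \<Rightarrow> bool" where
  "ideal_conv S I X f x \<longleftrightarrow> (\<forall>U. nbhd X x U \<longrightarrow> f -` U \<inter> S \<in> dual_filter S I)"

definition ideal_pair_conv ::
  "'a set \<Rightarrow> 'a set set \<Rightarrow> 'a set set \<Rightarrow> 'b topology \<Rightarrow> ('a \<Rightarrow> 'b) \<Rightarrow> 'b \<Rightarrow> bool" where
  "ideal_pair_conv S I K X f x \<longleftrightarrow>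
     (\<exists>M \<in> dual_filter S I. ideal_conv S K X (\<lambda>s. if s \<in> M then f s else x) x)"

definition additive_property :: "'a set set \<Rightarrow> 'a set set \<Rightarrow> bool" where
  "additive_property I K \<longleftrightarrow>
     (\<forall>A :: nat \<Rightarrow> 'a set. (\<forall>n. A n \<in> I) \<longrightarrow> (\<exists>B\<in>I. \<forall>n. A n - B \<in> K))"

end

theory Submission
  imports Defs
begin

text \<open>Fix a countable neighbourhood base \<open>V n\<close> at \<open>x\<close>. By
  \<I>-convergence each exceptional set of points of \<open>S\<close> that \<open>f\<close> sends
  outside \<open>V n\<close> lies in \<open>I\<close>. The additive property yields one
  \<open>A\<close> in \<open>I\<close> that absorbs all of these sets up to members of
  \<open>K\<close>. Resetting \<open>f\<close> to \<open>x\<close> on \<open>A\<close> leaves, for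
  each neighbourhood of \<open>x\<close>, only exceptional points from such a remainder, so
  \<open>S - A\<close> witnesses the convergence. First countability enters through
  \<open>first_countable_sequence_base\<close>, since the additive property handles only
  sequences.\<close>

lemma dual_filter_iff:
  assumes "set_ideal S I" and "B \<subseteq> S"
  shows "B \<in> dual_filter S I \<longleftrightarrow> S - B \<in> I"
proof
  assume "B \<in> dual_filter S I"
  then obtain A where "A \<in> I" and "B = S - A"
    by (auto simp: dual_filter_def)
  moreover have "A \<subseteq> S"
    using assms(1) \<open>A \<in> I\<close> by (auto simp: set_ideal_def)
  ultimately show "S - B \<in> I"
    by (simp add: double_diff)
next
  assume "S - B \<in> I"
  moreover have "B = S - (S - B)"
    using assms(2) by blast
  ultimately show "B \<in> dual_filter S I"
    unfolding dual_filter_def by blast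
qed

text \<open>Discard from a countable local base the sets that miss \<open>x\<close> and enumerate
  the rest. Repetitions are harmless, so a finite base also gives a sequence.\<close>

lemma first_countable_sequence_base:
  assumes "first_countable X" and "x \<in> topspace X"
  obtains V :: "nat \<Rightarrow> 'b set" where "\<And>n. openin X (V n)" and "\<And>n. x \<in> V n"
    and "\<And>U. openin X U \<Longrightarrow> x \<in> U \<Longrightarrow> \<exists>n. V n \<subseteq> U"
proof -
  obtain B where "countable B" and B_open: "\<And>V. V \<in> B \<Longrightarrow> openin X V"
    and B_base: "\<And>U. openin X U \<Longrightarrow> x \<in> U \<Longrightarrow> \<exists>V\<in>B. x \<in> V \<and> V \<subseteq> U"
    using assms unfolding first_countable_def by metis
  define C where "C = {V \<in> B. x \<in> V}"
  have "countable C"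
    using \<open>countable B\<close> by (simp add: C_def)
  moreover have "C \<noteq> {}"
    \<comment> \<open>The whole space is an open set around \<open>x\<close>, so some base set lies
      in it. Without a member of \<open>C\<close>, \<open>from_nat_into\<close> would not enumerate
      \<open>C\<close>.\<close>
    using B_base[of "topspace X"] assms(2) by (auto simp: C_def)
  ultimately have "range (from_nat_into C) = C"
    by (simp add: range_from_nat_into)
  then have mem: "from_nat_into C n \<in> C" and surj: "V \<in> C \<Longrightarrow> \<exists>n. V = from_nat_into C n" for n V
    by blast+
  show thesis
  proof
    fix n
    show "openin X (from_nat_into C n)" and "x \<in> from_nat_into C n"
      using mem[of n] B_open by (auto simp: C_def)
  next
    fix U assume "openin X U" and "x \<in> U"
    then obtain V where "V \<in> C" and "V \<subseteq> U"
      using B_base by (auto simp: C_def)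
    then show "\<exists>n. from_nat_into C n \<subseteq> U"
      using surj by blast
  qed
qed

theorem theorem3p11:
  fixes S :: "'a set" and I K :: "'a set set" and X :: "'b topology"
  assumes "set_ideal S I" and "set_ideal S K"
    and "first_countable X"
    and "additive_property I K"
  shows "\<forall>f \<in> S \<rightarrow> topspace X. \<forall>x \<in> topspace X.
           ideal_conv S I X f x \<longrightarrow> ideal_pair_conv S I K X f x"
proof (intro ballI impI)
  fix f x
  assume x: "x \<in> topspace X" and conv: "ideal_conv S I X f x"
  obtain V :: "nat \<Rightarrow> 'b set" where V_open: "\<And>n. openin X (V n)" and x_V: "\<And>n. x \<in> V n"
    and V_base: "\<And>U. openin X U \<Longrightarrow> x \<in> U \<Longrightarrow> \<exists>n. V n \<subseteq> U"
    using first_countable_sequence_base[OF assms(3) x] by blast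
  have "nbhd X x (V n)" for n
    using V_open x_V openin_subset unfolding nbhd_def by blast
  then have "S - f -` V n \<inter> S \<in> I" for n
    using conv dual_filter_iff[OF assms(1)] by (simp add: ideal_conv_def)
  then obtain A where "A \<in> I" and A: "\<And>n. (S - f -` V n \<inter> S) - A \<in> K"
    using assms(4)[unfolded additive_property_def, rule_format, of "\<lambda>n. S - f -` V n \<inter> S"]
    by blast
  \<comment> \<open>This is the modified function of \<open>ideal_pair_conv\<close> for
    \<open>M = S - A\<close>.\<close>
  define g where "g = (\<lambda>s. if s \<in> S - A then f s else x)"
  have "ideal_conv S K X g x"
    unfolding ideal_conv_def
  proof (intro allI impI)
    fix U assume "nbhd X x U"
    then obtain n where "V n \<subseteq> U" and "x \<in> U"
      using V_base unfolding nbhd_def by (meson order_trans subsetD)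
    \<comment> \<open>On \<open>A\<close> the value of \<open>g\<close> is \<open>x\<close>, which
      lies in \<open>U\<close>, so no exceptional point is in \<open>A\<close>. On the rest of
      \<open>S\<close>, \<open>g\<close> is \<open>f\<close>, and missing \<open>U\<close> implies
      missing \<open>V n\<close>.\<close>
    then have "S - g -` U \<inter> S \<subseteq> (S - f -` V n \<inter> S) - A"
      by (auto simp: g_def)
    then have "S - g -` U \<inter> S \<in> K"
      using A assms(2) unfolding set_ideal_def by blast
    then show "g -` U \<inter> S \<in> dual_filter S K"
      by (simp add: dual_filter_iff[OF assms(2)])
  qed
  moreover have "S - A \<in> dual_filter S I"
    using \<open>A \<in> I\<close> by (auto simp: dual_filter_def)
  ultimately show "ideal_pair_conv S I K X f x"
    unfolding ideal_pair_conv_def g_def by blast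
qed

end
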